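(* Let $G\le O_n(\mathbb{R})$ be a finite group. Consider the following procedure (the generalized Dirichlet domain construction): set $F:=\mathbb{R}^n$, $G_0:=G$, $i:=1$. While $i\le n$ and $G_{i-1}$ does not fix $\mathbb{R}^n$ pointwise: choose any $\gamma_i\in\mathbb{R}^n$ such that $g\gamma_i\neq\gamma_i$ for some $g\in G_{i-1}$; let $G_i:=\{g\in G_{i-1}: g\gamma_i=\gamma_i\}$; choose any transversal $H_i$ (a set of representatives of the left cosets) of $G_i$ in $G_{i-1}$ and replace $H_i$ by $H_i\cup H_i^{-1}$; set $F_i:=\{x\in\mathbb{R}^n:\gamma_i^t x\ge \gamma_i^t hx\ \ \forall h\in H_i\}$; set $F:=F\cap F_i$ and $i:=i+1$. Finally return $F$. Then, for any choices made in the procedure, the returned set $F$ is a fundamental domain for $G$.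
   Context: A subset $F\subseteq\mathbb{R}^n$ is a fundamental domain for a finite $G\le O_n(\mathbb{R})$ if (1) $F$ is closed and convex, (2) the sets $\mathrm{int}(gF)$, $g\in G$, are pairwise disjoint, and (3) $\mathbb{R}^n=\bigcup_{g\in G} gF$. For $S\subseteq G$, $S^{-1}=\{g^{-1}:g\in S\}$. *)

theory Defs
  imports "HOL-Analysis.Analysis" "HOL-Algebra.Left_Coset"
begin

definition orthogonal_group :: "(real^'n^'n) monoid" where
  "orthogonal_group =
     \<lparr>carrier = {A. orthogonal_matrix A}, mult = (\<lambda>A B. A ** B), one = mat 1\<rparr>"

lemma group_orthogonal_group: "group (orthogonal_group :: (real^'n^'n) monoid)"
proof (rule groupI)
  fix A :: "real^'n^'n"
  assume "A \<in> carrier orthogonal_group"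
  then show "\<exists>B\<in>carrier orthogonal_group.
      B \<otimes>\<^bsub>orthogonal_group\<^esub> A = \<one>\<^bsub>orthogonal_group\<^esub>"
    by (intro bexI[of _ "transpose A"]) (auto simp: orthogonal_group_def orthogonal_matrix_def)
qed (auto simp: orthogonal_group_def orthogonal_matrix_mul orthogonal_matrix_id
       matrix_mul_assoc)

definition fundamental_domain :: "(real^'n^'n) set \<Rightarrow> (real^'n) set \<Rightarrow> bool" where
  "fundamental_domain G F \<longleftrightarrow>
     closed F \<and> convex F \<and>
     disjoint_family_on (\<lambda>g. interior ((\<lambda>x. g *v x) ` F)) G \<and>
     (\<Union>g\<in>G. (\<lambda>x. g *v x) ` F) = UNIV"

definition fixes_pointwise :: "(real^'n^'n) set \<Rightarrow> bool" where
  "fixes_pointwise K \<longleftrightarrow> (\<forall>g\<in>K. \<forall>x. g *v x = x)"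

definition left_transversal ::
    "(real^'n^'n) set \<Rightarrow> (real^'n^'n) set \<Rightarrow> (real^'n^'n) set \<Rightarrow> bool" where
  "left_transversal H L K \<longleftrightarrow>
     H \<subseteq> K \<and> (\<forall>C \<in> lcosets\<^bsub>orthogonal_group\<lparr>carrier := K\<rparr>\<^esub> L. \<exists>!h. h \<in> H \<and> h \<in> C)"

text \<open>A state of the generalized Dirichlet domain construction is a triple
  \<open>(F, K, i)\<close> of the current region, the current group \<open>G\<^bsub>i-1\<^esub>\<close>
  and the loop counter. The arbitrary choices in the loop body make
  \<open>dirichlet_step\<close> a relation rather than a function.\<close>

definition dirichlet_guard :: "(real^'n^'n) set \<Rightarrow> nat \<Rightarrow> bool" where
  "dirichlet_guard (K :: (real^'n^'n) set) i \<longleftrightarrow> i \<le> CARD('n) \<and> \<not> fixes_pointwise K"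

inductive dirichlet_step ::
    "(real^'n) set \<times> (real^'n^'n) set \<times> nat \<Rightarrow> (real^'n) set \<times> (real^'n^'n) set \<times> nat \<Rightarrow> bool"
where
  "\<lbrakk> dirichlet_guard K i;
     \<exists>g\<in>K. g *v \<gamma> \<noteq> \<gamma>;
     K' = {g \<in> K. g *v \<gamma> = \<gamma>};
     left_transversal T K' K;
     H = T \<union> set_inv\<^bsub>orthogonal_group\<^esub> T;
     F' = {x. \<forall>h\<in>H. \<gamma> \<bullet> x \<ge> \<gamma> \<bullet> (h *v x)} \<rbrakk>
   \<Longrightarrow> dirichlet_step (F, K, i) (F \<inter> F', K', i + 1)"

definition dirichlet_returns :: "(real^'n^'n) set \<Rightarrow> (real^'n) set \<Rightarrow> bool" where
  "dirichlet_returns G F \<longleftrightarrow>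
     (\<exists>K i. dirichlet_step\<^sup>*\<^sup>* (UNIV, G, 1) (F, K, i) \<and> \<not> dirichlet_guard K i)"

end

theory Submission
  imports Defs
begin

text \<open>
  Since \<open>h\<gamma>\<close> depends only on the left coset \<open>hG\<^sub>i\<close>, the set
  \<open>H\<^sub>i \<union> H\<^sub>i\<^sup>-\<^sup>1\<close> sees the whole orbit of \<open>\<gamma>\<^sub>i\<close>, and \<open>F\<^sub>i\<close> is the Dirichlet cell of
  \<open>\<gamma>\<^sub>i\<close> with respect to \<open>G\<^bsub>i-1\<^esub>\<close>. Maximising \<open>\<gamma>\<^sub>i \<bullet> gx\<close> over \<open>g \<in> G\<^bsub>i-1\<^esub>\<close> moves any
  point into this cell; the cell is invariant under \<open>G\<^sub>i\<close>; and two translates by elements in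
  different cosets of \<open>G\<^sub>i\<close> meet in a hyperplane. Hence, after each step, the translates of \<open>F\<close>
  cover the space and overlap only if they coincide up to \<open>G\<^sub>i\<close>. The fixed space of \<open>G\<^sub>i\<close>
  contains \<open>\<gamma>\<^sub>i\<close> in addition to that of \<open>G\<^bsub>i-1\<^esub>\<close>, so its dimension grows in every step and
  the final group is trivial.
\<close>

text \<open>As a simp rule this rewrites \<open>transpose A *v x\<close> to \<open>x v* A\<close>
  and hides that transposes are the group inverses.\<close>

declare transpose_matrix_vector [simp del]

lemma inner_matrix_vector_transpose:
  fixes A :: "real^'n^'m"
  shows "x \<bullet> (A *v y) = (transpose A *v x) \<bullet> y"
  by (simp add: dot_lmul_matrix transpose_matrix_vector)

lemma orthogonal_matrix_vector_cancel [simp]: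
  fixes A :: "real^'n^'n"
  assumes "orthogonal_matrix A"
  shows "transpose A *v (A *v x) = x" "A *v (transpose A *v x) = x"
  using assms by (simp_all add: matrix_vector_mul_assoc orthogonal_matrix_def)

lemma inv_orthogonal_group:
  assumes "orthogonal_matrix A"
  shows "inv\<^bsub>orthogonal_group\<^esub> A = transpose A"
  by (rule group.inv_equality[OF group_orthogonal_group])
    (use assms in \<open>auto simp: orthogonal_group_def orthogonal_matrix_def\<close>)

lemma subgroup_orthogonal_group_iff:
  "subgroup K orthogonal_group \<longleftrightarrow>
     (\<forall>g\<in>K. orthogonal_matrix g \<and> transpose g \<in> K) \<and> mat 1 \<in> K \<and> (\<forall>g\<in>K. \<forall>h\<in>K. g ** h \<in> K)"
  (is "_ \<longleftrightarrow> ?R")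
proof
  assume K: "subgroup K orthogonal_group"
  then have "orthogonal_matrix g" if "g \<in> K" for g
    using subgroup.subset[OF K] that by (auto simp: orthogonal_group_def)
  with K show ?R
    using subgroup.m_inv_closed[OF K] subgroup.one_closed[OF K] subgroup.m_closed[OF K]
    by (auto simp: orthogonal_group_def inv_orthogonal_group[unfolded orthogonal_group_def])
next
  assume ?R
  then show "subgroup K orthogonal_group"
    by (intro group.subgroupI[OF group_orthogonal_group])
      (auto simp: inv_orthogonal_group, auto simp: orthogonal_group_def)
qed

lemma subgroup_stabilizer:
  assumes "subgroup K orthogonal_group"
  shows "subgroup {g \<in> K. g *v \<gamma> = \<gamma>} orthogonal_group"
proof -
  have "transpose g *v \<gamma> = \<gamma>" if "g \<in> K" "g *v \<gamma> = \<gamma>" for g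
    using assms that orthogonal_matrix_vector_cancel(1)[of g \<gamma>]
    by (simp add: subgroup_orthogonal_group_iff)
  then show ?thesis
    using assms
    by (auto simp: subgroup_orthogonal_group_iff simp flip: matrix_vector_mul_assoc)
qed

text \<open>For a subgroup \<open>K\<close> of \<open>orthogonal_group\<close> this is the Voronoi
  cell of \<gamma> in its orbit: \<open>transpose g *v \<gamma>\<close> has the norm of \<gamma>, so
  the inequality for \<open>g\<close> says that \<open>x\<close> is at least as near to \<gamma> as
  to \<open>transpose g *v \<gamma>\<close>.\<close>

definition dirichlet_cell :: "(real^'n^'n) set \<Rightarrow> real^'n \<Rightarrow> (real^'n) set" where
  "dirichlet_cell K \<gamma> = {x. \<forall>g\<in>K. \<gamma> \<bullet> (g *v x) \<le> \<gamma> \<bullet> x}"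

lemma dirichlet_cell_eq_Inter_halfspaces:
  "dirichlet_cell K \<gamma> = (\<Inter>g\<in>K. {x. (transpose g *v \<gamma> - \<gamma>) \<bullet> x \<le> 0})"
  by (auto simp: dirichlet_cell_def inner_matrix_vector_transpose inner_diff_left)

lemma closed_dirichlet_cell: "closed (dirichlet_cell K \<gamma>)"
  unfolding dirichlet_cell_eq_Inter_halfspaces by (intro closed_INT ballI closed_halfspace_le)

lemma convex_dirichlet_cell: "convex (dirichlet_cell K \<gamma>)"
  unfolding dirichlet_cell_eq_Inter_halfspaces by (intro convex_INT convex_halfspace_le)

lemma dirichlet_cell_transversal:
  assumes K: "subgroup K orthogonal_group"
    and T: "left_transversal T {g \<in> K. g *v \<gamma> = \<gamma>} K"
  shows "{x. \<forall>h \<in> T \<union> set_inv\<^bsub>orthogonal_group\<^esub> T. \<gamma> \<bullet> x \<ge> \<gamma> \<bullet> (h *v x)} = dirichlet_cell K \<gamma>"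
    (is "?L = _")
proof
  note K' = K[unfolded subgroup_orthogonal_group_iff]
  have TK: "T \<subseteq> K" using T by (simp add: left_transversal_def)
  have inv_T: "set_inv\<^bsub>orthogonal_group\<^esub> T = transpose ` T"
    using TK K' by (auto simp: SET_INV_def inv_orthogonal_group subset_iff)
  show "dirichlet_cell K \<gamma> \<subseteq> ?L"
    using TK K' by (auto simp: dirichlet_cell_def inv_T)
  show "?L \<subseteq> dirichlet_cell K \<gamma>"
  proof
    fix x assume x: "x \<in> ?L"
    have "\<gamma> \<bullet> (g *v x) \<le> \<gamma> \<bullet> x" if g: "g \<in> K" for g
    proof -
      \<comment> \<open>The constraint of \<open>g\<close> depends only on
        \<open>transpose g *v \<gamma>\<close>, that is, on the left coset \<open>?C\<close> of the
        inverse of \<open>g\<close> (\<open>?L\<close> now denotes the stabilizer). Its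
        representative \<open>t\<close> gives the same constraint through
        \<open>transpose t\<close>, which lies in the adjoined set of inverses.\<close>
      let ?L = "{g \<in> K. g *v \<gamma> = \<gamma>}"
      let ?C = "(\<lambda>l. transpose g ** l) ` ?L"
      have gT: "transpose g \<in> K" using K' g by blast
      have "?C \<in> lcosets\<^bsub>orthogonal_group\<lparr>carrier := K\<rparr>\<^esub> ?L"
        using gT by (auto simp: LCOSETS_def l_coset_def orthogonal_group_def)
      then obtain t where t: "t \<in> T" "t \<in> ?C"
        using T unfolding left_transversal_def by blast
      then have t\<gamma>: "t *v \<gamma> = transpose g *v \<gamma>"
        by (auto simp flip: matrix_vector_mul_assoc)
      have "\<gamma> \<bullet> (g *v x) = \<gamma> \<bullet> (transpose t *v x)"
        by (simp add: inner_matrix_vector_transpose t\<gamma>)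
      also have "\<dots> \<le> \<gamma> \<bullet> x" using x t(1) by (auto simp: inv_T)
      finally show ?thesis .
    qed
    then show "x \<in> dirichlet_cell K \<gamma>" by (simp add: dirichlet_cell_def)
  qed
qed

text \<open>The value \<gamma> \<bullet> x does not change under \<open>g\<close>, and the
  constraint of \<open>h\<close> at \<open>g *v x\<close> is that of \<open>h ** g\<close> at
  \<open>x\<close>.\<close>

lemma dirichlet_cell_stabilizer_invariant:
  assumes K: "subgroup K orthogonal_group"
    and g: "g \<in> K" "g *v \<gamma> = \<gamma>" and x: "x \<in> dirichlet_cell K \<gamma>"
  shows "g *v x \<in> dirichlet_cell K \<gamma>"
proof -
  note K' = K[unfolded subgroup_orthogonal_group_iff]
  have "transpose g *v \<gamma> = \<gamma>"
    using K' g orthogonal_matrix_vector_cancel(1)[of g \<gamma>] by simp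
  then have "\<gamma> \<bullet> (g *v x) = \<gamma> \<bullet> x" by (simp add: inner_matrix_vector_transpose)
  moreover have "h ** g \<in> K" if "h \<in> K" for h using K' g that by blast
  ultimately show ?thesis
    using x by (auto simp: dirichlet_cell_def matrix_vector_mul_assoc)
qed

lemma dirichlet_cell_cover:
  assumes K: "subgroup K orthogonal_group" "finite K"
  shows "\<exists>g\<in>K. g *v x \<in> dirichlet_cell K \<gamma>"
proof -
  note K' = K(1)[unfolded subgroup_orthogonal_group_iff]
  let ?f = "\<lambda>g. \<gamma> \<bullet> (g *v x)"
  have "finite (?f ` K)" "?f ` K \<noteq> {}" using K K' by auto
  from Max_in[OF this] obtain g where g: "g \<in> K" "Max (?f ` K) = ?f g" by auto
  have "?f (h ** g) \<le> ?f g" if "h \<in> K" for h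
    using that g K' \<open>finite (?f ` K)\<close> by (metis Max_ge imageI)
  then show ?thesis
    using g(1) by (auto simp: dirichlet_cell_def matrix_vector_mul_assoc)
qed

text \<open>A common point is z = g x = g k y with x and y in the cell, so x = k y. The two cell
  inequalities then bound \<gamma> \<bullet> x and \<gamma> \<bullet> y by each other, and z is
  orthogonal to g k \<gamma> - g \<gamma>. Unless that vector vanishes, the overlap lies in a
  hyperplane and has empty interior.\<close>

lemma dirichlet_cell_translates_overlap:
  assumes K: "subgroup K orthogonal_group" and g: "orthogonal_matrix g" and k: "k \<in> K"
    and meet: "interior ((\<lambda>x. g *v x) ` dirichlet_cell K \<gamma>)
        \<inter> interior ((\<lambda>x. (g ** k) *v x) ` dirichlet_cell K \<gamma>) \<noteq> {}"
      (is "interior ?A \<inter> interior ?B \<noteq> {}")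
  shows "k *v \<gamma> = \<gamma>"
proof -
  note K' = K[unfolded subgroup_orthogonal_group_iff]
  let ?v = "g *v (k *v \<gamma>) - g *v \<gamma>"
  have zero: "?v \<bullet> z = 0" if z: "z \<in> ?A" "z \<in> ?B" for z
  proof -
    from z obtain x y where x: "x \<in> dirichlet_cell K \<gamma>" "z = g *v x"
      and y: "y \<in> dirichlet_cell K \<gamma>" "z = g *v (k *v y)"
      by (auto simp flip: matrix_vector_mul_assoc)
    have ok: "orthogonal_matrix k" "transpose k \<in> K" using K' k by auto
    have xy: "x = k *v y" using x y g by (metis orthogonal_matrix_vector_cancel(1))
    have "transpose k *v x = y" using xy ok by simp
    with x(1) ok(2) have "\<gamma> \<bullet> y \<le> \<gamma> \<bullet> x"
      unfolding dirichlet_cell_def by blast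
    moreover have "\<gamma> \<bullet> x \<le> \<gamma> \<bullet> y"
      using y(1) k xy by (simp add: dirichlet_cell_def)
    moreover have "(g *v \<gamma>) \<bullet> z = \<gamma> \<bullet> x" "(g *v (k *v \<gamma>)) \<bullet> z = \<gamma> \<bullet> y"
      using g ok by (simp_all add: x(2) xy inner_matrix_vector_transpose)
    ultimately show ?thesis by (simp add: inner_diff_left)
  qed
  have "?v = 0"
  proof (rule ccontr)
    assume "?v \<noteq> 0"
    then have "interior {z. ?v \<bullet> z = 0} = {}" by (rule interior_hyperplane)
    moreover have "interior ?A \<inter> interior ?B \<subseteq> interior {z. ?v \<bullet> z = 0}"
      unfolding interior_Int[symmetric] using zero by (intro interior_mono) auto
    ultimately show False using meet by auto
  qed
  then show ?thesis
    using g by (metis eq_iff_diff_eq_0 orthogonal_matrix_vector_cancel(1))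
qed

definition fixed_space :: "(real^'n^'n) set \<Rightarrow> (real^'n) set" where
  "fixed_space K = {x. \<forall>g\<in>K. g *v x = x}"

lemma subspace_fixed_space: "subspace (fixed_space K)"
  by (auto simp: subspace_def fixed_space_def matrix_vector_right_distrib matrix_vector_mult_scaleR)

text \<open>The form with \<open>\<le>\<close> matches the lower bound on the dimension that is
  known when the loop counter exceeds \<open>CARD('n)\<close>.\<close>

lemma fixes_pointwise_iff_dim_fixed_space:
  fixes K :: "(real^'n^'n) set"
  shows "fixes_pointwise K \<longleftrightarrow> CARD('n) \<le> dim (fixed_space K)"
proof -
  have "fixes_pointwise K \<longleftrightarrow> fixed_space K = UNIV"
    by (auto simp: fixes_pointwise_def fixed_space_def)
  also have "\<dots> \<longleftrightarrow> span (fixed_space K) = UNIV"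
    unfolding span_eq_iff[THEN iffD2, OF subspace_fixed_space] ..
  also have "\<dots> \<longleftrightarrow> dim (fixed_space K) = CARD('n)"
    unfolding dim_eq_full[symmetric] by simp
  also have "\<dots> \<longleftrightarrow> CARD('n) \<le> dim (fixed_space K)"
    using dim_subset_UNIV_cart[of "fixed_space K"] by linarith
  finally show ?thesis .
qed

lemma dim_fixed_space_stabilizer:
  assumes "\<exists>g\<in>K. g *v \<gamma> \<noteq> \<gamma>"
  shows "dim (fixed_space K) < dim (fixed_space {g \<in> K. g *v \<gamma> = \<gamma>})"
proof (rule dim_psubset)
  show "span (fixed_space K) \<subset> span (fixed_space {g \<in> K. g *v \<gamma> = \<gamma>})"
    unfolding span_eq_iff[THEN iffD2, OF subspace_fixed_space]
    using assms by (auto simp: fixed_space_def)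
qed

text \<open>The loop invariant: \<open>F\<close> is a fundamental domain up to the cosets of
  \<open>K\<close>, hence a true one once \<open>K\<close> is trivial. Stability of \<open>F\<close>
  under \<open>K\<close> is what preserves the covering in the next step.\<close>

definition dirichlet_invariant ::
    "(real^'n^'n) set \<Rightarrow> (real^'n) set \<times> (real^'n^'n) set \<times> nat \<Rightarrow> bool" where
  "dirichlet_invariant G = (\<lambda>(F, K, i).
     subgroup K orthogonal_group \<and> K \<subseteq> G \<and> closed F \<and> convex F \<and>
     (\<forall>k\<in>K. \<forall>x\<in>F. k *v x \<in> F) \<and>
     (\<forall>y. \<exists>g\<in>G. \<exists>x\<in>F. y = g *v x) \<and>
     (\<forall>g\<in>G. \<forall>h\<in>G. interior ((\<lambda>x. g *v x) ` F) \<inter> interior ((\<lambda>x. h *v x) ` F) \<noteq> {}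
        \<longrightarrow> (\<exists>k\<in>K. h = g ** k)) \<and>
     i \<le> dim (fixed_space K) + 1)"

lemma dirichlet_invariant_init:
  assumes G: "subgroup G orthogonal_group"
  shows "dirichlet_invariant G (UNIV, G, 1)"
proof -
  note G' = G[unfolded subgroup_orthogonal_group_iff]
  have "\<exists>k\<in>G. h = g ** k" if "g \<in> G" "h \<in> G" for g h
    using G' that
    by (intro bexI[of _ "transpose g ** h"]) (auto simp: matrix_mul_assoc orthogonal_matrix_def)
  moreover have "\<exists>g\<in>G. \<exists>x. y = g *v x" for y
    using G' by (intro bexI[of _ "mat 1"]) auto
  ultimately show ?thesis using G by (auto simp: dirichlet_invariant_def)
qed

lemma dirichlet_invariant_step:
  assumes G: "subgroup G orthogonal_group" "finite G"
    and step: "dirichlet_step s s'" and inv: "dirichlet_invariant G s"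
  shows "dirichlet_invariant G s'"
  using step
proof cases
  case (1 K i \<gamma> K' T H F' F)
  note G' = G(1)[unfolded subgroup_orthogonal_group_iff]
  from inv 1 have K: "subgroup K orthogonal_group" and KG: "K \<subseteq> G" and F: "closed F" "convex F"
    and KF: "\<And>k x. k \<in> K \<Longrightarrow> x \<in> F \<Longrightarrow> k *v x \<in> F"
    and cov: "\<And>y. \<exists>g\<in>G. \<exists>x\<in>F. y = g *v x"
    and disj: "\<And>g h. g \<in> G \<Longrightarrow> h \<in> G \<Longrightarrow>
      interior ((\<lambda>x. g *v x) ` F) \<inter> interior ((\<lambda>x. h *v x) ` F) \<noteq> {} \<Longrightarrow> \<exists>k\<in>K. h = g ** k"
    and dim: "i \<le> dim (fixed_space K) + 1"
    by (auto simp: dirichlet_invariant_def)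
  note K_iff = K[unfolded subgroup_orthogonal_group_iff]
  have F': "F' = dirichlet_cell K \<gamma>"
    using dirichlet_cell_transversal[OF K] 1 by simp
  have K'_eq: "K' = {g \<in> K. g *v \<gamma> = \<gamma>}" by fact
  have "subgroup K' orthogonal_group" "K' \<subseteq> G"
    using subgroup_stabilizer[OF K] KG by (auto simp: K'_eq)
  moreover have "closed (F \<inter> F')" "convex (F \<inter> F')"
    unfolding F'
    by (intro closed_Int convex_Int F closed_dirichlet_cell convex_dirichlet_cell)+
  moreover have "k *v x \<in> F \<inter> F'" if "k \<in> K'" "x \<in> F \<inter> F'" for k x
    using that KF dirichlet_cell_stabilizer_invariant[OF K] unfolding F' K'_eq by auto
  moreover have "\<exists>g\<in>G. \<exists>x\<in>F \<inter> F'. y = g *v x" for y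
  proof -
    obtain g x where g: "g \<in> G" "x \<in> F" "y = g *v x" using cov by blast
    \<comment> \<open>Moving \<open>x\<close> into the new cell by an element of \<open>K\<close>
      keeps it in \<open>F\<close>; the inverse of \<open>k\<close> is absorbed into the element of
      \<open>G\<close>.\<close>
    obtain k where k: "k \<in> K" "k *v x \<in> F'"
      using dirichlet_cell_cover[OF K finite_subset[OF KG G(2)]] unfolding F' by blast
    have "orthogonal_matrix k" "transpose k \<in> G" using K_iff k KG by auto
    then have "g ** transpose k \<in> G" "y = (g ** transpose k) *v (k *v x)"
      using G' g by (auto simp flip: matrix_vector_mul_assoc)
    with k KF g show ?thesis by blast
  qed
  moreover have "\<exists>k\<in>K'. h = g ** k"
    if g: "g \<in> G" and h: "h \<in> G" and meet: "interior ((\<lambda>x. g *v x) ` (F \<inter> F'))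
      \<inter> interior ((\<lambda>x. h *v x) ` (F \<inter> F')) \<noteq> {}" for g h
  proof -
    \<comment> \<open>An overlap for the intersection is one for \<open>F\<close> and for
      \<open>F'\<close>: the first puts \<open>h\<close> into the coset of \<open>g\<close>, the
      second makes the quotient \<open>k\<close> fix \<gamma>.\<close>
    have "interior ((\<lambda>x. a *v x) ` (F \<inter> F')) \<subseteq> interior ((\<lambda>x. a *v x) ` F)"
      "interior ((\<lambda>x. a *v x) ` (F \<inter> F')) \<subseteq> interior ((\<lambda>x. a *v x) ` F')" for a
      by (auto intro!: interior_mono)
    then have "interior ((\<lambda>x. g *v x) ` F) \<inter> interior ((\<lambda>x. h *v x) ` F) \<noteq> {}"
      and meet': "interior ((\<lambda>x. g *v x) ` F') \<inter> interior ((\<lambda>x. h *v x) ` F') \<noteq> {}"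
      using meet by blast+
    then obtain k where k: "k \<in> K" "h = g ** k" using disj g h by blast
    with dirichlet_cell_translates_overlap[OF K] meet' g G' have "k *v \<gamma> = \<gamma>"
      unfolding F' by blast
    with k K'_eq show ?thesis by blast
  qed
  moreover have "i + 1 \<le> dim (fixed_space K') + 1"
    using dim dim_fixed_space_stabilizer[OF \<open>\<exists>g\<in>K. g *v \<gamma> \<noteq> \<gamma>\<close>]
    by (simp add: K'_eq)
  ultimately show ?thesis
    unfolding \<open>s' = _\<close> dirichlet_invariant_def by simp
qed

theorem theorem2:
  fixes G :: "(real^'n^'n) set" and F :: "(real^'n) set"
  assumes "subgroup G orthogonal_group"
    and "finite G"
    and "dirichlet_returns G F"
  shows "fundamental_domain G F"
proof -
  obtain K i where steps: "dirichlet_step\<^sup>*\<^sup>* (UNIV, G, 1) (F, K, i)"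
    and stop: "\<not> dirichlet_guard K i"
    using assms(3) by (auto simp: dirichlet_returns_def)
  from steps have "dirichlet_invariant G (F, K, i)"
    by (induction rule: rtranclp_induct)
      (use assms(1,2) dirichlet_invariant_init dirichlet_invariant_step in blast)+
  then have F: "closed F" "convex F" and cov: "\<And>y. \<exists>g\<in>G. \<exists>x\<in>F. y = g *v x"
    and disj: "\<And>g h. g \<in> G \<Longrightarrow> h \<in> G \<Longrightarrow>
      interior ((\<lambda>x. g *v x) ` F) \<inter> interior ((\<lambda>x. h *v x) ` F) \<noteq> {} \<Longrightarrow> \<exists>k\<in>K. h = g ** k"
    and dim: "i \<le> dim (fixed_space K) + 1"
    by (auto simp: dirichlet_invariant_def)
  \<comment> \<open>If the loop stopped because i > n, then i - 1 \<ge> n bounds the dimension of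
    the fixed space from below, so both exits leave the same situation.\<close>
  have "fixes_pointwise K"
    using stop dim by (auto simp: dirichlet_guard_def fixes_pointwise_iff_dim_fixed_space)
  then have "k = mat 1" if "k \<in> K" for k
    using that by (simp add: fixes_pointwise_def matrix_eq)
  with disj have "disjoint_family_on (\<lambda>g. interior ((\<lambda>x. g *v x) ` F)) G"
    unfolding disjoint_family_on_def by (metis matrix_mul_rid)
  moreover have "(\<Union>g\<in>G. (\<lambda>x. g *v x) ` F) = UNIV"
    using cov by blast
  ultimately show ?thesis
    using F by (simp add: fundamental_domain_def)
qed

end
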